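(* Let $n\ge 2$, $m\ge 1$. Assume that $\alpha_i>1$ and $l_i>0$ for every $i\in\{1,\dots,m\}$, and that $g:\mathbb{R}^n\to\mathbb{R}$ is locally Lipschitz continuous on $\mathbb{R}^n$. Then the function $V^g(\mathbf{y})=\min_{x\in\mathcal{D}^*(\mathbf{y})}g(x)$ is a viscosity solution of the Dirichlet problem $$\begin{cases} H(\mathbf{y},DV(\mathbf{y}))=0, & \mathbf{y}\in\Omega,\\ V(\mathbf{y})=g(x_E), & \mathbf{y}\in\partial\mathcal{T},\end{cases}\qquad H(\mathbf{y},\mathbf{p})=-\sum_{i=1}^m\alpha_i\|p_{P_i}\|+\|p_E\|.$$ That is: $V^g$ is continuous on $\Omega\cup\partial\mathcal{T}$; $V^g$ is a viscosity solution of $H(\mathbf{y},DV(\mathbf{y}))=0$ in $\Omega$; and $V^g(\mathbf{y})=g(x_E)$ for all $\mathbf{y}\in\partial\mathcal{T}$.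
   Context: $\|\cdot\|$ is the Euclidean norm. Points of $\mathbb{R}^{(m+1)n}$ are written $\mathbf{y}=(x_{P_1}^\top,\dots,x_{P_m}^\top,x_E^\top)^\top$ and $\mathbf{p}=(p_{P_1}^\top,\dots,p_{P_m}^\top,p_E^\top)^\top$ with all blocks in $\mathbb{R}^n$. $\mathcal{T}=\{\mathbf{y}:\min_i(\|x_{P_i}-x_E\|-l_i)\le 0\}$, $\partial\mathcal{T}=\{\mathbf{y}:\min_i(\|x_{P_i}-x_E\|-l_i)=0\}$, $\Omega=\mathbb{R}^{(m+1)n}\setminus\mathcal{T}$. For $\|x_{P_i}-x_E\|\ge l_i$, let $d_i(x;x_{P_i},x_E)=-\|x-x_{P_i}\|+\alpha_i\|x-x_E\|+l_i$, $\mathcal{D}_i(x_{P_i},x_E)=\{x\in\mathbb{R}^n:d_i(x;x_{P_i},x_E)\le 0\}$, and $\mathcal{D}^*(\mathbf{y})=\bigcap_{i=1}^m\mathcal{D}_i(x_{P_i},x_E)$. For $f:\Omega\to\mathbb{R}$ and $\mathbf{y}\in\Omega$, the superdifferential $D^+f(\mathbf{y})$ is the set of $\mathbf{p}$ with $\limsup_{\mathbf{y}'\to\mathbf{y}}\frac{f(\mathbf{y}')-f(\mathbf{y})-\mathbf{p}^\top(\mathbf{y}'-\mathbf{y})}{\|\mathbf{y}'-\mathbf{y}\|}\le 0$, and the subdifferential $D^-f(\mathbf{y})$ is the set of $\mathbf{p}$ with $\liminf_{\mathbf{y}'\to\mathbf{y}}\frac{f(\mathbf{y}')-f(\mathbf{y})-\mathbf{p}^\top(\mathbf{y}'-\mathbf{y})}{\|\mathbf{y}'-\mathbf{y}\|}\ge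 0$. A continuous $f:\Omega\to\mathbb{R}$ is a viscosity solution of $H(\mathbf{y},Df(\mathbf{y}))=0$ in $\Omega$ if for every $\mathbf{y}\in\Omega$: $H(\mathbf{y},\mathbf{p})\le 0$ for all $\mathbf{p}\in D^+f(\mathbf{y})$ (subsolution) and $H(\mathbf{y},\mathbf{p})\ge 0$ for all $\mathbf{p}\in D^-f(\mathbf{y})$ (supersolution). *)

theory Defs
  imports "HOL-Analysis.Analysis"
begin

(* A point (x_P, x_E) of R^((m+1)n), m = CARD('m), n = CARD('n): fst is the tuple of the blocks
   x_{P_i} (fst y $ i), snd is x_E.  The library norm and inner product of this type are the
   Euclidean ones of R^((m+1)n). *)
type_synonym ('n, 'm) state = "(real ^ 'n ^ 'm) \<times> (real ^ 'n)"

definition gap :: "('m \<Rightarrow> real) \<Rightarrow> ('n::finite, 'm::finite) state \<Rightarrow> real" where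
  "gap l y = Min (range (\<lambda>i. norm (fst y $ i - snd y) - l i))"

definition target :: "('m \<Rightarrow> real) \<Rightarrow> ('n::finite, 'm::finite) state set" where
  "target l = {y. gap l y \<le> 0}"

definition target_boundary :: "('m \<Rightarrow> real) \<Rightarrow> ('n::finite, 'm::finite) state set" where
  "target_boundary l = {y. gap l y = 0}"

definition game_domain :: "('m \<Rightarrow> real) \<Rightarrow> ('n::finite, 'm::finite) state set" where
  "game_domain l = UNIV - target l"

(* Meant for norm (xP - xE) \<ge> l; total here, but only used on the closure of the game domain. *)
definition dom_fun :: "real \<Rightarrow> real \<Rightarrow> real ^ 'n \<Rightarrow> real ^ 'n \<Rightarrow> real ^ 'n \<Rightarrow> real" where
  "dom_fun a l xP xE x = - norm (x - xP) + a * norm (x - xE) + l"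

definition dom_region :: "real \<Rightarrow> real \<Rightarrow> real ^ 'n \<Rightarrow> real ^ 'n \<Rightarrow> (real ^ 'n) set" where
  "dom_region a l xP xE = {x. dom_fun a l xP xE x \<le> 0}"

definition joint_region ::
  "('m \<Rightarrow> real) \<Rightarrow> ('m \<Rightarrow> real) \<Rightarrow> ('n::finite, 'm::finite) state \<Rightarrow> (real ^ 'n) set" where
  "joint_region \<alpha> l y = (\<Inter>i. dom_region (\<alpha> i) (l i) (fst y $ i) (snd y))"

(* LEAST on the set of values is the minimum; it is unspecified where no minimum is attained. *)
definition value_fun ::
  "('m \<Rightarrow> real) \<Rightarrow> ('m \<Rightarrow> real) \<Rightarrow> (real ^ 'n \<Rightarrow> real) \<Rightarrow> ('n::finite, 'm::finite) state \<Rightarrow> real" where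
  "value_fun \<alpha> l g y = (LEAST v. v \<in> g ` joint_region \<alpha> l y)"

definition hamiltonian ::
  "('m \<Rightarrow> real) \<Rightarrow> ('n::finite, 'm::finite) state \<Rightarrow> ('n, 'm) state \<Rightarrow> real" where
  "hamiltonian \<alpha> y p = - (\<Sum>i\<in>UNIV. \<alpha> i * norm (fst p $ i)) + norm (snd p)"

(* "at y within S" is the punctured neighbourhood filter: y' tends to y with y' in S, y' \<noteq> y. *)
definition superdifferential ::
  "'a::euclidean_space set \<Rightarrow> ('a \<Rightarrow> real) \<Rightarrow> 'a \<Rightarrow> 'a set" where
  "superdifferential S f y =
     {p. Limsup (at y within S)
           (\<lambda>y'. ereal ((f y' - f y - p \<bullet> (y' - y)) / norm (y' - y))) \<le> 0}"

definition subdifferential ::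
  "'a::euclidean_space set \<Rightarrow> ('a \<Rightarrow> real) \<Rightarrow> 'a \<Rightarrow> 'a set" where
  "subdifferential S f y =
     {p. Liminf (at y within S)
           (\<lambda>y'. ereal ((f y' - f y - p \<bullet> (y' - y)) / norm (y' - y))) \<ge> 0}"

definition viscosity_solution ::
  "'a::euclidean_space set \<Rightarrow> ('a \<Rightarrow> 'a \<Rightarrow> real) \<Rightarrow> ('a \<Rightarrow> real) \<Rightarrow> bool" where
  "viscosity_solution S H f \<longleftrightarrow>
     continuous_on S f \<and>
     (\<forall>y\<in>S. \<forall>p\<in>superdifferential S f y. H y p \<le> 0) \<and>
     (\<forall>y\<in>S. \<forall>p\<in>subdifferential S f y. H y p \<ge> 0)"

end

theory Submission
  imports Defs
begin

text \<open>Shrinking towards \<open>x\<^sub>E\<close> decreases each \<open>d\<^sub>i\<close> at rate at least \<open>\<alpha>\<^sub>i - 1\<close>, so a point with all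
  \<open>d\<^sub>i \<le> \<delta>\<close> lies within \<open>\<delta> / min\<^sub>i (\<alpha>\<^sub>i - 1)\<close> of \<open>\<D>\<^sup>*\<close>. Hence \<open>\<D>\<^sup>*\<close> is Lipschitz in the state, and \<open>V\<close>
  is locally Lipschitz. Supersolution: against any pursuer motion with speeds at most \<open>\<alpha>\<^sub>i\<close>, an evader
  heading for a minimizer of \<open>g\<close> keeps it in \<open>\<D>\<^sup>*\<close>, so \<open>V\<close> does not increase. Subsolution: against an
  evader moving along \<open>e\<close>, every pursuer heads for the point where the ray along \<open>e\<close> leaves \<open>\<D>\<^sub>i\<close>;
  then \<open>\<D>\<^sup>*\<close> grows only to second order in time, so \<open>V\<close> does not decrease to first order. Testing
  semidifferentials along these motions gives both inequalities for \<open>H\<close>.\<close>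

section \<open>Geometry of a single function \<open>dom_fun\<close>\<close>

text \<open>Moving towards \<open>E\<close> lowers the term \<open>a * norm (x - E)\<close> by
  \<open>a\<close> per unit length, while by the triangle inequality the distance to
  \<open>P\<close> drops by at most 1 per unit length.\<close>

lemma dom_fun_shrink:
  assumes "0 \<le> t" "t \<le> 1"
  shows "dom_fun a l P E (E + t *\<^sub>R (x - E)) + (1 - t) * (a - 1) * norm (x - E) \<le> dom_fun a l P E x"
proof -
  have eq: "x - P = (E + t *\<^sub>R (x - E) - P) + (1 - t) *\<^sub>R (x - E)"
    by (simp add: algebra_simps)
  have "norm (x - P) \<le> norm (E + t *\<^sub>R (x - E) - P) + norm ((1 - t) *\<^sub>R (x - E))"
    by (subst eq) (rule norm_triangle_ineq)
  moreover have "norm ((1 - t) *\<^sub>R (x - E)) = (1 - t) * norm (x - E)"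
    using assms by simp
  moreover have "norm (E + t *\<^sub>R (x - E) - E) = t * norm (x - E)"
    using assms by simp
  ultimately show ?thesis
    unfolding dom_fun_def by (simp add: algebra_simps)
qed

lemma dom_fun_perturb:
  assumes "a \<ge> 0"
  shows "dom_fun a l P E x \<le> dom_fun a l P' E' x + norm (P' - P) + a * norm (E' - E)"
proof -
  have "norm (x - P') \<le> norm (x - P) + norm (P' - P)"
    using norm_triangle_ineq4[of "x - P" "P' - P"] by simp
  moreover have "norm (x - E) \<le> norm (x - E') + norm (E' - E)"
    using norm_triangle_ineq[of "x - E'" "E' - E"] by simp
  then have "a * norm (x - E) \<le> a * norm (x - E') + a * norm (E' - E)"
    using assms by (simp flip: distrib_left add: mult_left_mono)
  ultimately show ?thesis
    unfolding dom_fun_def by simp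
qed

lemma ray_hits_boundary:
  fixes e :: "real ^ 'n"
  assumes "a > 1" "norm e = 1" "dom_fun a l P E E < 0"
  obtains r where "r > 0" "dom_fun a l P E (E + r *\<^sub>R e) = 0"
proof -
  define \<phi> where "\<phi> r = dom_fun a l P E (E + r *\<^sub>R e)" for r
  \<comment> \<open>By distance \<open>b\<close> the guaranteed growth rate \<open>a - 1\<close>
    along the ray has made up for the negative value at \<open>E\<close>, so a zero lies in
    \<open>{0..b}\<close>.\<close>
  define b where "b = - dom_fun a l P E E / (a - 1)"
  have b: "b > 0"
    using assms by (simp add: b_def divide_neg_pos)
  have "dom_fun a l P E (E + 0 *\<^sub>R (b *\<^sub>R e)) + (a - 1) * b \<le> \<phi> b"
    using dom_fun_shrink[of 0 a l P E "E + b *\<^sub>R e"] b assms by (simp add: \<phi>_def)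
  then have "\<phi> b \<ge> 0"
    using assms by (simp add: b_def)
  moreover have "continuous_on {0..b} \<phi>"
    unfolding \<phi>_def dom_fun_def by (intro continuous_intros)
  moreover have "\<phi> 0 < 0"
    using assms by (simp add: \<phi>_def)
  ultimately obtain r where "0 \<le> r" "\<phi> r = 0"
    using IVT'[of \<phi> 0 0 b] b by auto
  moreover have "r \<noteq> 0"
    using \<open>\<phi> 0 < 0\<close> \<open>\<phi> r = 0\<close> by auto
  ultimately show ?thesis
    using that[of r] by (simp add: \<phi>_def)
qed

lemma norm_diff_le_second_order:
  fixes v z :: "'a::real_inner"
  assumes "norm z < norm v"
  shows "norm (v - z) \<le> norm v - v \<bullet> z / norm v + (norm z)\<^sup>2 / (2 * norm v)"
proof -
  \<comment> \<open>Chosen so that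
    \<open>(norm (v - z))\<^sup>2 = (norm v)\<^sup>2 + 2 * norm v * B\<close>, which falls short of
    \<open>(norm v + B)\<^sup>2\<close> by a square. Since \<open>z\<close> is shorter than
    \<open>v\<close>, the sum \<open>norm v + B\<close> is nonnegative and roots can be
    taken.\<close>
  define B where "B = (- 2 * (v \<bullet> z) + (norm z)\<^sup>2) / (2 * norm v)"
  have v: "norm v > 0"
    using assms norm_ge_zero[of z] by linarith
  have "v \<bullet> z \<le> norm v * norm z"
    by (rule norm_cauchy_schwarz)
  also have "\<dots> \<le> norm v * norm v"
    using assms by (intro mult_left_mono) auto
  finally have "0 \<le> 2 * (norm v * norm v) - 2 * (v \<bullet> z)"
    by simp
  moreover have "norm v + B = (2 * (norm v * norm v) - 2 * (v \<bullet> z) + (norm z)\<^sup>2) / (2 * norm v)"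
    using v by (simp add: B_def field_simps)
  ultimately have "norm v + B \<ge> 0"
    by simp
  moreover have "(norm (v - z))\<^sup>2 \<le> (norm v + B)\<^sup>2"
  proof -
    have "(norm (v - z))\<^sup>2 = (norm v)\<^sup>2 + 2 * norm v * B"
      using v by (simp add: B_def power2_norm_eq_inner inner_diff inner_commute)
    then show ?thesis
      by (simp add: power2_sum)
  qed
  ultimately have "norm (v - z) \<le> norm v + B"
    using power2_le_imp_le by blast
  also have "norm v + B = norm v - v \<bullet> z / norm v + (norm z)\<^sup>2 / (2 * norm v)"
    by (simp add: B_def add_divide_distrib diff_divide_distrib)
  finally show ?thesis .
qed

text \<open>The norm is convex, so it lies above its tangent at \<open>u\<close>; this is
  Cauchy-Schwarz against \<open>u\<close>.\<close>

lemma norm_diff_ge_first_order: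
  fixes u z :: "'a::real_inner"
  assumes "u \<noteq> 0"
  shows "norm (u - z) \<ge> norm u - u \<bullet> z / norm u"
proof -
  have "u \<bullet> (u - z) \<le> norm u * norm (u - z)"
    by (rule norm_cauchy_schwarz)
  then show ?thesis
    using assms by (simp add: field_simps inner_diff_right power2_norm_eq_inner flip: power2_eq_square)
qed

text \<open>If the evader moves along \<open>e\<close> while the pursuer heads for the point \<open>E + r0 e\<close> where that ray
  leaves the region, the region grows at most to second order in time: comparing the two triangles
  over the chord from \<open>x\<close> to \<open>E + r0 e\<close>, the angle seen from \<open>P\<close> is at most the one seen from \<open>E\<close>,
  up to an error quadratic in the amount \<open>d\<close> by which \<open>x\<close> lies outside.\<close>

lemma dom_fun_pursuit_growth:
  fixes e :: "real ^ 'n"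
  assumes a: "a > 1" and l: "l > 0" and r0: "r0 > 0" and e: "norm e = 1"
    and bd: "dom_fun a l P E (E + r0 *\<^sub>R e) = 0"
    and h: "0 < h" "h \<le> 1" "h \<le> l / (4 * a)"
    and E: "dom_fun a l P E E < 0"
    and x: "dom_fun a l (P + h *\<^sub>R (a *\<^sub>R sgn (E + r0 *\<^sub>R e - P))) (E + h *\<^sub>R e) x \<le> 0"
  shows "dom_fun a l P E x \<le> (a\<^sup>2 / l + 4 * a ^ 3 / ((a\<^sup>2 - 1) * l\<^sup>2)) * h\<^sup>2"
proof (cases "dom_fun a l P E x \<le> 0")
  case True
  have "a\<^sup>2 > 1"
    using a by simp
  then have "(a\<^sup>2 / l + 4 * a ^ 3 / ((a\<^sup>2 - 1) * l\<^sup>2)) * h\<^sup>2 \<ge> 0"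
    using a l by (intro mult_nonneg_nonneg add_nonneg_nonneg divide_nonneg_nonneg) auto
  then show ?thesis
    using True by linarith
next
  case False
  define d where "d = dom_fun a l P E x"
  define u where "u = x - E"
  define v where "v = x - P"
  define v0 where "v0 = E + r0 *\<^sub>R e - P"
  define r where "r = norm u"
  define R where "R = norm v"
  define R0 where "R0 = norm v0"
  define w where "w = sgn v0"
  \<comment> \<open>\<open>A\<close> and \<open>B\<close> are one minus the cosine of the angle
    between the direction to \<open>x\<close> and the direction of motion, seen from
    \<open>P\<close> and from \<open>E\<close>.\<close>
  define A where "A = 1 - v \<bullet> w / R"
  define B where "B = 1 - u \<bullet> e / r"
  have a2: "a\<^sup>2 > 1"
    using a by simp
  have d: "d > 0" "d = a * r + l - R"
    using False by (auto simp: d_def dom_fun_def u_def v_def r_def R_def)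
  have R0: "R0 = a * r0 + l"
    using bd r0 e by (simp add: dom_fun_def R0_def v0_def)
  have R0l: "R0 \<ge> l" "R0 \<ge> r0"
    using R0 a r0 l by (auto simp: mult_le_cancel_right1 intro: add_increasing2)
  have R0p: "R0 > 0"
    using R0l l by simp
  have w: "norm w = 1" "v0 = R0 *\<^sub>R w"
    using R0p by (auto simp: w_def R0_def norm_sgn sgn_div_norm)
  have u0: "u \<noteq> 0"
    using E False by (auto simp: u_def)
  then have rp: "r > 0"
    by (simp add: r_def)
  \<comment> \<open>The displacements \<open>a * h\<close> of \<open>P\<close> and \<open>h\<close>
    of \<open>E\<close> change \<open>dom_fun\<close> by at most \<open>a * h\<close> each. With
    \<open>h \<le> l / (4 * a)\<close> this gives \<open>d \<le> l / 2\<close>, which keeps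
    \<open>R\<close> at least \<open>l / 2\<close>.\<close>
  have "d \<le> 2 * a * h"
    using dom_fun_perturb[of a l P E x "P + h *\<^sub>R (a *\<^sub>R w)" "E + h *\<^sub>R e"] x a h w e
    by (simp add: d_def w_def v0_def)
  moreover have ha: "a * h \<le> l / 4"
    using h a by (simp add: field_simps)
  ultimately have dl: "d \<le> l / 2" "d \<le> 2 * a * h"
    by auto
  have "r \<le> a * r"
    using a rp by simp
  then have R: "R \<ge> l / 2" "R \<ge> r"
    using d dl l rp by linarith+
  have Rp: "R > 0"
    using R l by simp
  \<comment> \<open>Both distances after the motion are expanded in \<open>h\<close>; the
    first-order terms combine to \<open>h * a * (B - A)\<close>, so it remains to bound
    \<open>A - B\<close> from above.\<close>
  have "norm (u - h *\<^sub>R e) \<ge> r - h * (u \<bullet> e) / r"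
    using norm_diff_ge_first_order[OF u0, of "h *\<^sub>R e"] by (simp add: r_def)
  then have 1: "a * norm (u - h *\<^sub>R e) \<ge> a * (r - h * (u \<bullet> e) / r)"
    using a by (intro mult_left_mono) auto
  have "norm ((h * a) *\<^sub>R w) < norm v"
    using w h a ha R l by (simp add: R_def mult.commute abs_mult)
  from norm_diff_le_second_order[OF this]
  have 2: "norm (v - (h * a) *\<^sub>R w) \<le> R - h * a * (v \<bullet> w) / R + (h * a)\<^sup>2 / (2 * R)"
    using w by (simp add: R_def)
  have "- norm (v - (h * a) *\<^sub>R w) + a * norm (u - h *\<^sub>R e) + l \<le> 0"
    using x by (simp add: dom_fun_def u_def v_def w_def v0_def diff_diff_eq)
  then have "d + h * a * (B - A) - (h * a)\<^sup>2 / (2 * R) \<le> 0"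
    using 1 2 d unfolding A_def B_def by (simp add: algebra_simps)
  then have 3: "d \<le> h * a * (A - B) + (h * a)\<^sup>2 / (2 * R)"
    by (simp add: algebra_simps)
  \<comment> \<open>Law of cosines for the chord from \<open>x\<close> to
    \<open>E + r0 *\<^sub>R e\<close>, once with apex \<open>P\<close> and once with apex
    \<open>E\<close>.\<close>
  have "v - v0 = u - r0 *\<^sub>R e"
    by (simp add: v_def v0_def u_def)
  then have "(norm (v - R0 *\<^sub>R w))\<^sup>2 = (norm (u - r0 *\<^sub>R e))\<^sup>2"
    using w by simp
  moreover have "(norm (v - R0 *\<^sub>R w))\<^sup>2 = R\<^sup>2 + R0\<^sup>2 - 2 * R0 * (v \<bullet> w)"
    using w unfolding R_def power2_norm_eq_inner
    by (simp add: inner_diff inner_commute power2_eq_square norm_eq_1)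
  moreover have "(norm (u - r0 *\<^sub>R e))\<^sup>2 = r\<^sup>2 + r0\<^sup>2 - 2 * r0 * (u \<bullet> e)"
    using e unfolding r_def power2_norm_eq_inner
    by (simp add: inner_diff inner_commute power2_eq_square norm_eq_1)
  moreover have "v \<bullet> w = R - R * A" "u \<bullet> e = r - r * B"
    using Rp rp by (auto simp: A_def B_def field_simps)
  ultimately have 4: "(R - R0)\<^sup>2 + 2 * R * R0 * A = (r - r0)\<^sup>2 + 2 * r * r0 * B"
    by (simp add: power2_eq_square algebra_simps)
  have RR0: "R - R0 = a * (r - r0) - d"
    using d(2) R0 by (simp add: algebra_simps)
  \<comment> \<open>Completing the square in \<open>r - r0\<close>: the difference of squares is at
    least \<open>- d\<^sup>2 / (a\<^sup>2 - 1)\<close>, whatever \<open>r\<close> is.\<close>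
  have "(a\<^sup>2 - 1) * ((R - R0)\<^sup>2 - (r - r0)\<^sup>2) + d\<^sup>2 = ((a\<^sup>2 - 1) * (r - r0) - a * d)\<^sup>2"
    unfolding RR0 by (simp add: power2_eq_square algebra_simps)
  then have "(a\<^sup>2 - 1) * ((R - R0)\<^sup>2 - (r - r0)\<^sup>2) + d\<^sup>2 \<ge> 0"
    by simp
  moreover have "(R - R0)\<^sup>2 - (r - r0)\<^sup>2 = - (2 * R * R0 * A - 2 * r * r0 * B)"
    using 4 by simp
  ultimately have "(2 * R * R0 * A - 2 * r * r0 * B) * (a\<^sup>2 - 1) \<le> d\<^sup>2"
    by (simp only: mult_minus_right) (simp add: mult.commute)
  then have 5: "2 * R * R0 * A - 2 * r * r0 * B \<le> d\<^sup>2 / (a\<^sup>2 - 1)"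
    using a2 by (simp add: pos_le_divide_eq)
  have "u \<bullet> e \<le> r"
    using norm_cauchy_schwarz[of u e] e by (simp add: r_def)
  then have "B \<ge> 0"
    using rp by (simp add: B_def)
  moreover have "r * r0 \<le> R * R0"
    using R R0l rp r0 by (intro mult_mono) auto
  ultimately have "2 * r * r0 * B \<le> 2 * R * R0 * B"
    by (simp add: mult_right_mono)
  with 5 have 6: "2 * R * R0 * (A - B) \<le> d\<^sup>2 / (a\<^sup>2 - 1)"
    by (simp add: algebra_simps)
  have dd: "d\<^sup>2 / (a\<^sup>2 - 1) \<ge> 0"
    using a2 by simp
  have RR: "l\<^sup>2 \<le> 2 * R * R0"
    using mult_mono[of "l" "2 * R" l R0] R R0l l by (simp add: power2_eq_square)
  \<comment> \<open>The excess \<open>d\<close> is at most \<open>2 * a * h\<close>, so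
    \<open>A - B\<close> is bounded by a multiple of \<open>h\<^sup>2\<close> and
    \<open>h * a * (A - B)\<close> even by one of third order; \<open>h \<le> 1\<close> absorbs the
    extra factor.\<close>
  have "A - B \<le> d\<^sup>2 / (a\<^sup>2 - 1) / (2 * R * R0)"
    using 6 Rp R0p by (subst pos_le_divide_eq) (auto simp: mult_ac)
  also have "\<dots> \<le> d\<^sup>2 / (a\<^sup>2 - 1) / l\<^sup>2"
    using dd RR l Rp R0p by (intro divide_left_mono) auto
  also have "\<dots> \<le> (2 * a * h)\<^sup>2 / (a\<^sup>2 - 1) / l\<^sup>2"
    using dl d a2 by (intro divide_right_mono power_mono) auto
  finally have "h * a * (A - B) \<le> h * a * ((2 * a * h)\<^sup>2 / (a\<^sup>2 - 1) / l\<^sup>2)"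
    using h a by (intro mult_left_mono) auto
  also have "\<dots> = h * (4 * a ^ 3 / ((a\<^sup>2 - 1) * l\<^sup>2) * h\<^sup>2)"
    by (simp add: power2_eq_square power3_eq_cube)
  also have "\<dots> \<le> 1 * (4 * a ^ 3 / ((a\<^sup>2 - 1) * l\<^sup>2) * h\<^sup>2)"
    using h a a2 by (intro mult_right_mono mult_nonneg_nonneg divide_nonneg_nonneg) auto
  finally have 7: "h * a * (A - B) \<le> 4 * a ^ 3 / ((a\<^sup>2 - 1) * l\<^sup>2) * h\<^sup>2"
    by simp
  have "(h * a)\<^sup>2 / (2 * R) \<le> (h * a)\<^sup>2 / l"
    using R l Rp by (intro divide_left_mono) auto
  then show ?thesis
    using 3 7 unfolding d_def by (simp add: algebra_simps power_mult_distrib)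
qed

section \<open>Testing semidifferentials along rays\<close>

lemma eventually_less_at_right:
  fixes a b :: real
  assumes "a < b"
  shows "\<forall>\<^sub>F h in at_right a. h < b"
  using eventually_at_right_real[OF assms] by (rule eventually_mono) auto

lemma inner_sgn_self: "x \<bullet> sgn x = norm (x :: 'a::real_inner)"
  by (cases "x = 0") (simp_all add: sgn_div_norm power2_eq_square flip: power2_norm_eq_inner)

lemma filterlim_along_ray:
  fixes y v :: "'a::euclidean_space"
  assumes "open S" "y \<in> S" "v \<noteq> 0"
  shows "filterlim (\<lambda>h. y + h *\<^sub>R v) (at y within S) (at_right 0)"
proof -
  have lim: "((\<lambda>h::real. y + h *\<^sub>R v) \<longlongrightarrow> y) (at_right 0)"
    by (auto intro!: tendsto_eq_intros)
  have "\<forall>\<^sub>F h in at_right 0. y + h *\<^sub>R v \<in> S"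
    using topological_tendstoD[OF lim assms(1,2)] .
  moreover have "\<forall>\<^sub>F h::real in at_right 0. h > 0"
    by (rule eventually_at_right_less)
  ultimately have "\<forall>\<^sub>F h in at_right 0. y + h *\<^sub>R v \<in> S \<and> y + h *\<^sub>R v \<noteq> y"
    by eventually_elim (use assms(3) in auto)
  then show ?thesis
    using lim by (auto simp: filterlim_at elim: eventually_mono)
qed

text \<open>Along the ray the difference quotient is at least
  \<open>- (p \<bullet> v) / norm v\<close> minus a multiple of \<open>h\<close>, because the
  quadratic loss is divided by \<open>h\<close>; the limsup bound then forces the sign.\<close>

lemma superdifferential_nonneg_direction:
  fixes y v :: "'a::euclidean_space"
  assumes "open S" "y \<in> S" and p: "p \<in> superdifferential S f y"
    and ev: "\<forall>\<^sub>F h in at_right 0. f y \<le> f (y + h *\<^sub>R v) + C * h\<^sup>2"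
  shows "p \<bullet> v \<ge> 0"
proof (cases "v = 0")
  case False
  have "- (p \<bullet> v) / norm v \<le> 0 + \<epsilon>" if "\<epsilon> > 0" for \<epsilon>
  proof -
    have "Limsup (at y within S) (\<lambda>y'. ereal ((f y' - f y - p \<bullet> (y' - y)) / norm (y' - y))) < ereal \<epsilon>"
      using p that unfolding superdifferential_def by (auto intro: le_less_trans)
    then have "\<forall>\<^sub>F y' in at y within S. (f y' - f y - p \<bullet> (y' - y)) / norm (y' - y) < \<epsilon>"
      using Limsup_lessD by fastforce
    then have "\<forall>\<^sub>F h in at_right 0.
        (f (y + h *\<^sub>R v) - f y - p \<bullet> (y + h *\<^sub>R v - y)) / norm (y + h *\<^sub>R v - y) < \<epsilon>"
      using filterlim_along_ray[OF assms(1,2) False] by (auto simp: filterlim_iff)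
    moreover have "\<forall>\<^sub>F h::real in at_right 0. h > 0"
      by (rule eventually_at_right_less)
    ultimately have "\<forall>\<^sub>F h in at_right 0. - (p \<bullet> v) / norm v - C * h / norm v \<le> \<epsilon>"
      using ev
    proof eventually_elim
      case (elim h)
      have "f (y + h *\<^sub>R v) - f y - h * (p \<bullet> v) < h * (\<epsilon> * norm v)"
        using elim False by (simp add: pos_divide_less_eq mult_ac)
      then have "h * (- (p \<bullet> v) - C * h) \<le> h * (\<epsilon> * norm v)"
        using elim(3) by (simp add: algebra_simps power2_eq_square)
      then have "- (p \<bullet> v) - C * h \<le> \<epsilon> * norm v"
        using elim(2) by simp
      then have "(- (p \<bullet> v) - C * h) / norm v \<le> \<epsilon>"
        using False by (simp add: pos_divide_le_eq)
      then show ?case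
        by (simp add: diff_divide_distrib)
    qed
    moreover have "((\<lambda>h. - (p \<bullet> v) / norm v - C * h / norm v) \<longlongrightarrow> - (p \<bullet> v) / norm v) (at_right 0)"
      using False by (auto intro!: tendsto_eq_intros)
    ultimately show ?thesis
      by (intro tendsto_upperbound[of _ _ "at_right (0::real)"]) (auto simp: trivial_limit_at_right_real)
  qed
  then have "- (p \<bullet> v) / norm v \<le> 0"
    by (rule field_le_epsilon)
  then show ?thesis
    using False by (simp add: field_simps)
qed simp

text \<open>Lets the same ray test serve the supersolution inequality, applied to the negated
  value.\<close>

lemma uminus_in_superdifferential:
  assumes "p \<in> subdifferential S f y"
  shows "- p \<in> superdifferential S (\<lambda>x. - f x) y"
proof -
  have eq: "(\<lambda>y'. ereal ((- f y' - - f y - (- p) \<bullet> (y' - y)) / norm (y' - y)))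
      = (\<lambda>y'. - ereal ((f y' - f y - p \<bullet> (y' - y)) / norm (y' - y)))"
    by (intro ext, simp only: uminus_ereal.simps minus_divide_left) (simp add: algebra_simps)
  show ?thesis
    using assms unfolding superdifferential_def subdifferential_def mem_Collect_eq eq ereal_Limsup_uminus
    by simp
qed

section \<open>Lipschitz constants on compact sets; blocks of states and the game domain\<close>

lemma locally_lipschitz_on_compact:
  fixes g :: "'a::metric_space \<Rightarrow> 'b::metric_space"
  assumes "\<And>x. \<exists>u>0. \<exists>L. L-lipschitz_on (cball x u) g" "compact K"
  obtains L where "L-lipschitz_on K g"
proof -
  \<comment> \<open>\<open>g\<close> is viewed as a time-dependent family over the single time 0,
    the setting in which compactness turns local into global Lipschitz bounds.\<close>
  have "local_lipschitz {0::real} K (\<lambda>_. g)"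
    unfolding local_lipschitz_def
  proof (intro ballI)
    fix x t
    obtain u L where "u > 0" "L-lipschitz_on (cball x u) g"
      using assms(1) by blast
    then show "\<exists>u>0. \<exists>L. \<forall>t\<in>cball t u \<inter> {0::real}. L-lipschitz_on (cball x u \<inter> K) g"
      by (meson inf_le1 lipschitz_on_subset)
  qed
  from local_lipschitz_compact_implies_lipschitz[OF this assms(2)]
  show ?thesis
    using that by auto
qed

lemma inner_state:
  fixes p :: "('n::finite, 'm::finite) state"
  shows "p \<bullet> (a, e) = (\<Sum>i\<in>UNIV. fst p $ i \<bullet> a $ i) + snd p \<bullet> e"
  by (simp add: inner_prod_def inner_vec_def[of "fst p" a])

lemma norm_state_blocks:
  fixes y :: "('n::finite, 'm::finite) state"
  shows "norm (fst y $ i) \<le> norm y" "norm (snd y) \<le> norm y"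
  using Finite_Cartesian_Product.norm_nth_le[of "fst y" i] norm_fst_le[of "fst y" "snd y"]
    norm_snd_le[of "snd y" "fst y"] by simp_all

lemma game_domain_iff: "y \<in> game_domain l \<longleftrightarrow> (\<forall>i. l i < norm (fst y $ i - snd y))"
  by (auto simp: game_domain_def target_def gap_def not_le)

lemma game_closure_iff:
  "y \<in> game_domain l \<union> target_boundary l \<longleftrightarrow> (\<forall>i. l i \<le> norm (fst y $ i - snd y))"
proof -
  have "y \<in> game_domain l \<union> target_boundary l \<longleftrightarrow> 0 \<le> gap l y"
    by (auto simp: game_domain_def target_def target_boundary_def)
  then show ?thesis
    by (simp add: gap_def)
qed

lemma open_game_domain: "open (game_domain l)"
proof -
  have "game_domain l = (\<Inter>i. {y. l i < norm (fst y $ i - snd y)})"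
    using game_domain_iff by blast
  also have "open \<dots>"
    by (intro open_INT ballI open_Collect_less continuous_intros finite)
  finally show ?thesis .
qed

lemma mem_joint_region:
  "x \<in> joint_region \<alpha> l y \<longleftrightarrow> (\<forall>i. dom_fun (\<alpha> i) (l i) (fst y $ i) (snd y) x \<le> 0)"
  by (auto simp: joint_region_def dom_region_def)

section \<open>The joint region and attainment of the minimum\<close>

locale pursuit_game =
  fixes \<alpha> l :: "'m::finite \<Rightarrow> real" and g :: "real ^ 'n::finite \<Rightarrow> real"
  assumes \<alpha>: "\<alpha> i > 1" and l: "l i > 0"
    and g: "\<exists>u>0. \<exists>L. L-lipschitz_on (cball x u) g"
begin

abbreviation "\<Omega> \<equiv> (game_domain l :: ('n, 'm) state set)"
abbreviation "\<Omega>\<^sub>c \<equiv> (game_domain l \<union> target_boundary l :: ('n, 'm) state set)"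
abbreviation "V \<equiv> value_fun \<alpha> l g"

lemma \<alpha>_nonneg: "\<alpha> i \<ge> 0"
  using \<alpha>[of i] by simp

text \<open>The slowest of the shrink rates: moving a distance \<delta> / c towards the evader
  removes an excess \<delta> from every \<open>dom_fun\<close> at once.\<close>

definition "c = Min (range (\<lambda>i. \<alpha> i - 1))"

lemma c: "c > 0" "c \<le> \<alpha> i - 1"
  using \<alpha> by (auto simp: c_def)

lemma evader_mem: "y \<in> \<Omega>\<^sub>c \<Longrightarrow> snd y \<in> joint_region \<alpha> l y"
  unfolding game_closure_iff mem_joint_region by (simp add: dom_fun_def norm_minus_commute)

text \<open>This is \<open>dom_fun_shrink\<close> with \<open>t = 0\<close>, shrinking all the way
  to the evader.\<close>

lemma norm_joint_region:
  assumes "x \<in> joint_region \<alpha> l y"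
  shows "(\<alpha> i - 1) * norm (x - snd y) \<le> norm (fst y $ i - snd y) - l i"
proof -
  have "dom_fun (\<alpha> i) (l i) (fst y $ i) (snd y) x \<le> 0"
    using assms by (simp add: mem_joint_region)
  then show ?thesis
    using dom_fun_shrink[of 0 "\<alpha> i" "l i" "fst y $ i" "snd y" x]
    by (simp add: dom_fun_def norm_minus_commute)
qed

text \<open>The radius depends on the state only through \<open>b\<close>, so one Lipschitz constant
  of \<open>g\<close> serves all states in a ball.\<close>

lemma joint_region_bounded:
  assumes "norm y \<le> b"
  shows "joint_region \<alpha> l y \<subseteq> cball 0 (b + 2 * b / c)"
proof
  fix x assume x: "x \<in> joint_region \<alpha> l y"
  fix i :: 'm
  have *: "norm (fst y $ i) \<le> b" "norm (snd y) \<le> b"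
    using norm_state_blocks[of y] assms order_trans by blast+
  have "c * norm (x - snd y) \<le> (\<alpha> i - 1) * norm (x - snd y)"
    using c by (intro mult_right_mono) auto
  also have "\<dots> \<le> 2 * b"
    using norm_joint_region[OF x, of i] norm_triangle_ineq4[of "fst y $ i" "snd y"] * l[of i] by linarith
  finally have "norm (x - snd y) \<le> 2 * b / c"
    using c by (simp add: field_simps)
  then show "x \<in> cball 0 (b + 2 * b / c)"
    using norm_triangle_ineq[of "snd y" "x - snd y"] * by simp
qed

lemma continuous_g: "continuous_on UNIV g"
proof -
  have "isCont g x" for x
  proof -
    obtain u L where u: "u > 0" "L-lipschitz_on (cball x u) g"
      using g by blast
    then have "x \<in> interior (cball x u)"
      by (simp add: interior_cball)
    then show ?thesis
      using continuous_on_interior[OF lipschitz_on_continuous_on[OF u(2)]] by blast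
  qed
  then show ?thesis
    by (simp add: continuous_on_eq_continuous_at)
qed

lemma compact_joint_region: "compact (joint_region \<alpha> l y)"
proof -
  have "joint_region \<alpha> l y = (\<Inter>i. {x. dom_fun (\<alpha> i) (l i) (fst y $ i) (snd y) x \<le> 0})"
    using mem_joint_region by blast
  moreover have "closed \<dots>"
    unfolding dom_fun_def by (intro closed_INT ballI closed_Collect_le continuous_intros)
  moreover have "bounded (joint_region \<alpha> l y)"
    using joint_region_bounded[OF order_refl] bounded_cball bounded_subset by blast
  ultimately show ?thesis
    by (simp add: compact_eq_bounded_closed)
qed

lemma value_fun_eqI:
  assumes "x \<in> joint_region \<alpha> l y" "\<And>x'. x' \<in> joint_region \<alpha> l y \<Longrightarrow> g x \<le> g x'"
  shows "V y = g x"
  unfolding value_fun_def using assms by (intro Least_equality) auto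

lemma value_attained:
  assumes "y \<in> \<Omega>\<^sub>c"
  obtains x where "x \<in> joint_region \<alpha> l y" "V y = g x"
    "\<And>x'. x' \<in> joint_region \<alpha> l y \<Longrightarrow> g x \<le> g x'"
proof -
  have "\<exists>x\<in>joint_region \<alpha> l y. \<forall>x'\<in>joint_region \<alpha> l y. g x \<le> g x'"
    using evader_mem[OF assms]
    by (intro continuous_attains_inf compact_joint_region continuous_on_subset[OF continuous_g]) auto
  then show ?thesis
    using that value_fun_eqI by blast
qed

lemma value_le:
  assumes "y \<in> \<Omega>\<^sub>c" "x \<in> joint_region \<alpha> l y"
  shows "V y \<le> g x"
  using value_attained[OF assms(1)] assms(2) by metis

section \<open>Stability of the value under changes of the state; boundary values\<close>

lemma near_joint_region:
  assumes y: "y \<in> \<Omega>\<^sub>c" and \<delta>: "\<delta> \<ge> 0"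
    and x: "\<And>i. dom_fun (\<alpha> i) (l i) (fst y $ i) (snd y) x \<le> \<delta>"
  obtains x' where "x' \<in> joint_region \<alpha> l y" "norm (x' - x) \<le> \<delta> / c"
proof (cases "norm (x - snd y) \<le> \<delta> / c")
  case True
  then show ?thesis
    using that[OF evader_mem[OF y]] by (simp add: norm_minus_commute)
next
  case False
  have n: "norm (x - snd y) > 0"
    using False \<delta> c by (meson divide_nonneg_pos le_less_trans not_le)
  \<comment> \<open>The solution of \<open>(1 - t) * c * norm (x - snd y) = \<delta>\<close>, so
    that shrinking by \<open>t\<close> uses up exactly the excess. It is nonnegative because
    \<open>x\<close> is far from the evader in this case; in the other case the evader's position
    itself is close enough.\<close>
  define t where "t = 1 - \<delta> / (c * norm (x - snd y))"
  have t: "0 \<le> t" "t \<le> 1"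
    using False n \<delta> c(1) by (auto simp: t_def field_simps)
  have ct: "(1 - t) * c * norm (x - snd y) = \<delta>"
    using n c(1) by (simp add: t_def)
  show ?thesis
  proof (rule that)
    show "snd y + t *\<^sub>R (x - snd y) \<in> joint_region \<alpha> l y"
      unfolding mem_joint_region
    proof
      fix i
      have "\<delta> \<le> (1 - t) * (\<alpha> i - 1) * norm (x - snd y)"
        unfolding ct[symmetric] using t c(2)[of i] by (intro mult_right_mono mult_left_mono) auto
      then show "dom_fun (\<alpha> i) (l i) (fst y $ i) (snd y) (snd y + t *\<^sub>R (x - snd y)) \<le> 0"
        using dom_fun_shrink[OF t, of "\<alpha> i" "l i" "fst y $ i" "snd y" x] x[of i] by linarith
    qed
    have "snd y + t *\<^sub>R (x - snd y) - x = (t - 1) *\<^sub>R (x - snd y)"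
      by (simp add: algebra_simps)
    then have "norm (snd y + t *\<^sub>R (x - snd y) - x) = (1 - t) * norm (x - snd y)"
      using t by simp
    also have "\<dots> = \<delta> / c"
      using ct c(1) by (simp add: field_simps)
    finally show "norm (snd y + t *\<^sub>R (x - snd y) - x) \<le> \<delta> / c"
      by simp
  qed
qed

text \<open>A minimizer for \<open>y'\<close> is moved into the joint region of \<open>y\<close> at
  cost \<delta> / c. With \<delta> linear in the distance of the states this yields Lipschitz
  continuity, with \<delta> quadratic in time the subsolution estimate.\<close>

lemma value_le_value:
  assumes "y \<in> \<Omega>\<^sub>c" "y' \<in> \<Omega>\<^sub>c" "\<delta> \<ge> 0"
    and b: "norm y \<le> b" "norm y' \<le> b" and L: "L-lipschitz_on (cball 0 (b + 2 * b / c)) g"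
    and *: "\<And>x i. x \<in> joint_region \<alpha> l y' \<Longrightarrow> dom_fun (\<alpha> i) (l i) (fst y $ i) (snd y) x \<le> \<delta>"
  shows "V y \<le> V y' + L * (\<delta> / c)"
proof -
  obtain x where x: "x \<in> joint_region \<alpha> l y'" "V y' = g x"
    using value_attained[OF assms(2)] by metis
  obtain x' where x': "x' \<in> joint_region \<alpha> l y" "norm (x' - x) \<le> \<delta> / c"
    using near_joint_region[OF assms(1,3) *[OF x(1)]] by metis
  have "dist (g x') (g x) \<le> L * dist x' x"
    using x x' joint_region_bounded[OF b(1)] joint_region_bounded[OF b(2)]
    by (intro lipschitz_onD[OF L]) auto
  also have "\<dots> \<le> L * (\<delta> / c)"
    using x' lipschitz_on_nonneg[OF L] by (intro mult_left_mono) (auto simp: dist_norm)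
  finally show ?thesis
    using value_le[OF assms(1) x'(1)] x(2) by (simp add: dist_real_def)
qed

lemma dom_fun_state_perturb:
  "dom_fun (\<alpha> i) (l i) (fst y $ i) (snd y) x
    \<le> dom_fun (\<alpha> i) (l i) (fst y' $ i) (snd y') x + (1 + Max (range \<alpha>)) * norm (y' - y)"
proof -
  have "norm (fst y' $ i - fst y $ i) \<le> norm (y' - y)"
    using norm_state_blocks(1)[of "y' - y" i] by simp
  moreover have "norm (snd y' - snd y) \<le> norm (y' - y)"
    using norm_state_blocks(2)[of "y' - y"] by simp
  then have "\<alpha> i * norm (snd y' - snd y) \<le> Max (range \<alpha>) * norm (y' - y)"
    using \<alpha>_nonneg[of i] by (intro mult_mono) (auto intro: order_trans[of 0 "\<alpha> i"])
  ultimately show ?thesis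
    using dom_fun_perturb[of "\<alpha> i" "l i" "fst y $ i" "snd y" x "fst y' $ i" "snd y'"] \<alpha>[of i]
    by (simp add: algebra_simps)
qed

lemma value_lipschitz:
  "\<exists>L. L-lipschitz_on (\<Omega>\<^sub>c \<inter> cball 0 b) V"
proof -
  obtain L where L: "L-lipschitz_on (cball 0 (b + 2 * b / c)) g"
    using locally_lipschitz_on_compact[OF g compact_cball] by metis
  define M where "M = 1 + Max (range \<alpha>)"
  \<comment> \<open>\<open>undefined\<close> merely stands for some index, to see that the maximum
    is nonnegative.\<close>
  have "\<alpha> undefined \<le> Max (range \<alpha>)"
    by simp
  then have M: "M \<ge> 0"
    using \<alpha>_nonneg[of undefined] unfolding M_def by linarith
  have le: "V y \<le> V y' + L * M / c * dist y y'"
    if "y \<in> \<Omega>\<^sub>c \<inter> cball 0 b" "y' \<in> \<Omega>\<^sub>c \<inter> cball 0 b" for y y'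
  proof -
    have "V y \<le> V y' + L * ((M * norm (y' - y)) / c)"
    proof (rule value_le_value[OF _ _ _ _ _ L])
      fix x i assume "x \<in> joint_region \<alpha> l y'"
      then show "dom_fun (\<alpha> i) (l i) (fst y $ i) (snd y) x \<le> M * norm (y' - y)"
        using dom_fun_state_perturb[of i y x y'] unfolding mem_joint_region M_def
        by (smt (verit))
    qed (use that M in auto)
    then show ?thesis
      by (simp add: dist_norm norm_minus_commute)
  qed
  have "(L * M / c)-lipschitz_on (\<Omega>\<^sub>c \<inter> cball 0 b) V"
  proof (rule lipschitz_onI)
    fix y y' assume "y \<in> \<Omega>\<^sub>c \<inter> cball 0 b" "y' \<in> \<Omega>\<^sub>c \<inter> cball 0 b"
    from le[OF this] le[OF this(2,1)]
    show "dist (V y) (V y') \<le> L * M / c * dist y y'"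
      by (simp add: dist_real_def dist_commute abs_le_iff)
  qed (use M c lipschitz_on_nonneg[OF L] in auto)
  then show ?thesis ..
qed

lemma continuous_on_value: "continuous_on \<Omega>\<^sub>c V"
proof -
  have "continuous (at y within \<Omega>\<^sub>c) V" if "y \<in> \<Omega>\<^sub>c" for y
  proof -
    \<comment> \<open>The margin 1 makes \<open>ball 0 b\<close> a neighbourhood of
      \<open>y\<close>, so continuity on the truncated set is continuity at
      \<open>y\<close>.\<close>
    define b where "b = norm y + 1"
    have "continuous_on (\<Omega>\<^sub>c \<inter> cball 0 b) V"
      using value_lipschitz lipschitz_on_continuous_on by blast
    then have "continuous (at y within \<Omega>\<^sub>c \<inter> cball 0 b) V"
      using that by (auto simp: continuous_on_eq_continuous_within b_def)
    moreover have "at y within \<Omega>\<^sub>c \<inter> cball 0 b = at y within \<Omega>\<^sub>c"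
      by (rule at_within_nhd[of _ "ball 0 b"]) (auto simp: b_def)
    ultimately show ?thesis
      by simp
  qed
  then show ?thesis
    by (simp add: continuous_on_eq_continuous_within)
qed

text \<open>A pursuer at distance exactly \<open>l i\<close> collapses the joint region to the
  evader's position.\<close>

lemma value_boundary:
  assumes "y \<in> target_boundary l"
  shows "V y = g (snd y)"
proof -
  have "gap l y = 0"
    using assms by (simp add: target_boundary_def)
  moreover have "gap l y \<in> range (\<lambda>i. norm (fst y $ i - snd y) - l i)"
    unfolding gap_def by (rule Min_in) auto
  ultimately obtain i where i: "norm (fst y $ i - snd y) = l i"
    by auto
  have eq: "x = snd y" if "x \<in> joint_region \<alpha> l y" for x
  proof -
    have "(\<alpha> i - 1) * norm (x - snd y) \<le> 0"
      using norm_joint_region[OF that, of i] i by simp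
    then show ?thesis
      using \<alpha>[of i] by (simp add: mult_le_0_iff)
  qed
  show ?thesis
  proof (rule value_fun_eqI)
    show "snd y \<in> joint_region \<alpha> l y"
      using evader_mem assms by blast
  qed (metis eq order_refl)
qed

section \<open>Motions of the two sides and their effect on the value\<close>

lemma eventually_in_domain:
  assumes "y \<in> \<Omega>"
  shows "\<forall>\<^sub>F h in at_right (0::real). y + h *\<^sub>R v \<in> \<Omega>"
proof -
  have "((\<lambda>h::real. y + h *\<^sub>R v) \<longlongrightarrow> y) (at_right 0)"
    by (auto intro!: tendsto_eq_intros)
  then show ?thesis
    using assms open_game_domain topological_tendstoD by blast
qed

text \<open>The evader runs straight at a minimizer \<open>x\<close>: in time \<open>h\<close> the
  weighted evader distance falls by \<open>\<alpha> i * h\<close>, the distance of pursuer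
  \<open>i\<close> by no more, so \<open>x\<close> stays in the joint region.\<close>

lemma value_along_evader_motion:
  assumes y: "y \<in> \<Omega>" and a: "\<And>i. norm (a $ i) \<le> \<alpha> i"
  obtains e where "norm e \<le> 1" "\<forall>\<^sub>F h in at_right 0. V (y + h *\<^sub>R (a, e)) \<le> V y"
proof -
  obtain x where x: "x \<in> joint_region \<alpha> l y" "V y = g x"
    using value_attained[of y] y by blast
  \<comment> \<open>If the evader is already at \<open>x\<close>, then \<open>sgn 0 = 0\<close>
    makes it stand still, and it stays in the region as long as the state stays in the
    domain.\<close>
  define e where "e = sgn (x - snd y)"
  have e: "norm e \<le> 1"
    by (simp add: e_def norm_sgn)
  have "\<forall>\<^sub>F h in at_right 0. x \<in> joint_region \<alpha> l (y + h *\<^sub>R (a, e))"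
  proof (cases "x = snd y")
    case True
    have "\<forall>\<^sub>F h in at_right 0. snd (y + h *\<^sub>R (a, e)) \<in> joint_region \<alpha> l (y + h *\<^sub>R (a, e))"
      using eventually_in_domain[OF y, of "(a, e)"] by eventually_elim (blast intro: evader_mem)
    then show ?thesis
      using True by (simp add: e_def)
  next
    case False
    \<comment> \<open>Before the evader reaches \<open>x\<close>, its distance to \<open>x\<close>
      is shortened by exactly \<open>h\<close>.\<close>
    then have "\<forall>\<^sub>F h in at_right 0. h < norm (x - snd y)"
      by (intro eventually_less_at_right) auto
    moreover have "\<forall>\<^sub>F h::real in at_right 0. h > 0"
      by (rule eventually_at_right_less)
    ultimately show ?thesis
    proof eventually_elim
      case (elim h)
      define s where "s = norm (x - snd y)"
      have "x - snd y = s *\<^sub>R e"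
        using False by (simp add: s_def e_def sgn_div_norm)
      then have "x - (snd y + h *\<^sub>R e) = (s - h) *\<^sub>R e"
        by (simp add: algebra_simps)
      then have 1: "norm (x - (snd y + h *\<^sub>R e)) = norm (x - snd y) - h"
        using elim False by (simp add: s_def e_def norm_sgn)
      show ?case
        unfolding mem_joint_region
      proof
        fix i
        have "norm (x - fst y $ i) \<le> norm (x - (fst y $ i + h *\<^sub>R a $ i)) + h * norm (a $ i)"
          using norm_triangle_ineq[of "x - (fst y $ i + h *\<^sub>R a $ i)" "h *\<^sub>R a $ i"] elim by simp
        also have "h * norm (a $ i) \<le> h * \<alpha> i"
          using a elim by (intro mult_left_mono) auto
        finally show "dom_fun (\<alpha> i) (l i) (fst (y + h *\<^sub>R (a, e)) $ i) (snd (y + h *\<^sub>R (a, e))) x \<le> 0"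
          using x(1)[unfolded mem_joint_region, rule_format, of i]
          by (simp add: dom_fun_def 1 right_diff_distrib mult.commute)
      qed
    qed
  qed
  with eventually_in_domain[OF y, of "(a, e)"] have "\<forall>\<^sub>F h in at_right 0. V (y + h *\<^sub>R (a, e)) \<le> V y"
    by eventually_elim (use value_le x(2) in auto)
  with e that show ?thesis
    by blast
qed

text \<open>With each pursuer heading for the exit point of the evader's ray,
  \<open>dom_fun_pursuit_growth\<close> puts every point of the later joint region within order
  \<open>h\<^sup>2\<close> of the present one.\<close>

lemma value_along_pursuer_motion:
  assumes y: "y \<in> \<Omega>" and e: "norm e = 1"
  obtains a C where "\<And>i. norm (a $ i) \<le> \<alpha> i"
    "\<forall>\<^sub>F h in at_right 0. V y \<le> V (y + h *\<^sub>R (a, e)) + C * h\<^sup>2"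
proof -
  have E: "dom_fun (\<alpha> i) (l i) (fst y $ i) (snd y) (snd y) < 0" for i
    using y by (simp add: game_domain_iff dom_fun_def norm_minus_commute)
  then have "\<exists>r>0. dom_fun (\<alpha> i) (l i) (fst y $ i) (snd y) (snd y + r *\<^sub>R e) = 0" for i
    using ray_hits_boundary[OF \<alpha> e E] by metis
  then obtain r where r: "\<And>i. r i > 0"
      "\<And>i. dom_fun (\<alpha> i) (l i) (fst y $ i) (snd y) (snd y + r i *\<^sub>R e) = 0"
    by metis
  define a where "a = (\<chi> i. \<alpha> i *\<^sub>R sgn (snd y + r i *\<^sub>R e - fst y $ i))"
  define k where "k i = (\<alpha> i)\<^sup>2 / l i + 4 * \<alpha> i ^ 3 / (((\<alpha> i)\<^sup>2 - 1) * (l i)\<^sup>2)" for i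
  \<comment> \<open>Bounds all states \<open>y + h *\<^sub>R (a, e)\<close> with \<open>h\<close>
    between 0 and 1, so that \<open>L\<close> does not depend on \<open>h\<close>.\<close>
  define b where "b = norm y + norm (a, e)"
  obtain L where L: "L-lipschitz_on (cball 0 (b + 2 * b / c)) g"
    using locally_lipschitz_on_compact[OF g compact_cball] by metis
  have k: "k i \<le> Max (range k)" for i
    by simp
  have "k i \<ge> 0" for i
  proof -
    have "(\<alpha> i)\<^sup>2 > 1"
      using \<alpha>[of i] by simp
    then show ?thesis
      unfolding k_def using \<alpha>[of i] l[of i]
      by (intro add_nonneg_nonneg divide_nonneg_nonneg mult_nonneg_nonneg) auto
  qed
  then have K: "Max (range k) \<ge> 0"
    using k order_trans by blast
  have na: "norm (a $ i) \<le> \<alpha> i" for i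
    using \<alpha>[of i] by (simp add: a_def norm_sgn)
  have "\<forall>\<^sub>F h in at_right 0. h < l i / (4 * \<alpha> i)" for i
    using l[of i] \<alpha>[of i] by (intro eventually_less_at_right) auto
  then have "\<forall>\<^sub>F h in at_right 0. \<forall>i. h < l i / (4 * \<alpha> i)"
    by (rule eventually_all_finite)
  moreover have "\<forall>\<^sub>F h::real in at_right 0. h < 1"
    by (intro eventually_less_at_right) auto
  moreover have "\<forall>\<^sub>F h::real in at_right 0. h > 0"
    by (rule eventually_at_right_less)
  ultimately have "\<forall>\<^sub>F h in at_right 0. V y \<le> V (y + h *\<^sub>R (a, e)) + (L * Max (range k) / c) * h\<^sup>2"
    using eventually_in_domain[OF y, of "(a, e)"]
  proof eventually_elim
    case (elim h)
    have "V y \<le> V (y + h *\<^sub>R (a, e)) + L * (Max (range k) * h\<^sup>2 / c)"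
    proof (rule value_le_value[OF _ _ _ _ _ L])
      have "norm (y + h *\<^sub>R (a, e)) \<le> norm y + norm (h *\<^sub>R (a, e))"
        by (rule norm_triangle_ineq)
      also have "\<dots> \<le> b"
        using elim mult_right_mono[of h 1 "norm (a, e)"] by (simp add: b_def del: scaleR_Pair)
      finally show "norm (y + h *\<^sub>R (a, e)) \<le> b" .
    next
      fix x i assume "x \<in> joint_region \<alpha> l (y + h *\<^sub>R (a, e))"
      then have "dom_fun (\<alpha> i) (l i) (fst y $ i + h *\<^sub>R (\<alpha> i *\<^sub>R sgn (snd y + r i *\<^sub>R e - fst y $ i)))
          (snd y + h *\<^sub>R e) x \<le> 0"
        by (simp add: mem_joint_region a_def)
      then have "dom_fun (\<alpha> i) (l i) (fst y $ i) (snd y) x \<le> k i * h\<^sup>2"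
        unfolding k_def using elim
        by (intro dom_fun_pursuit_growth[OF \<alpha> l r(1) e r(2) _ _ _ E]) (auto intro: less_imp_le)
      also have "\<dots> \<le> Max (range k) * h\<^sup>2"
        using k by (intro mult_right_mono) auto
      finally show "dom_fun (\<alpha> i) (l i) (fst y $ i) (snd y) x \<le> Max (range k) * h\<^sup>2" .
    qed (use y elim K in \<open>auto simp: b_def\<close>)
    then show ?case
      by simp
  qed
  with na that show ?thesis
    by blast
qed

section \<open>The two viscosity inequalities\<close>

lemma value_subsolution:
  assumes y: "y \<in> \<Omega>" and p: "p \<in> superdifferential \<Omega> V y"
  shows "hamiltonian \<alpha> y p \<le> 0"
proof (cases "snd p = 0")
  case True
  have "(\<Sum>i\<in>UNIV. \<alpha> i * norm (fst p $ i)) \<ge> 0"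
    using \<alpha>_nonneg by (intro sum_nonneg mult_nonneg_nonneg) auto
  then show ?thesis
    using True by (simp add: hamiltonian_def)
next
  case False
  \<comment> \<open>The evader direction opposite to the evader block of \<open>p\<close>
    contributes \<open>- norm (snd p)\<close> to the pairing; it is a unit vector since that block
    is nonzero here.\<close>
  define e where "e = - sgn (snd p)"
  have "norm e = 1"
    using False by (simp add: e_def norm_sgn)
  then obtain a C where a: "\<And>i. norm (a $ i) \<le> \<alpha> i"
      and C: "\<forall>\<^sub>F h in at_right 0. V y \<le> V (y + h *\<^sub>R (a, e)) + C * h\<^sup>2"
    using value_along_pursuer_motion[OF y] by blast
  have "0 \<le> p \<bullet> (a, e)"
    using superdifferential_nonneg_direction[OF open_game_domain y p C] .
  also have "\<dots> = (\<Sum>i\<in>UNIV. fst p $ i \<bullet> a $ i) - norm (snd p)"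
    by (simp add: inner_state e_def inner_sgn_self)
  also have "(\<Sum>i\<in>UNIV. fst p $ i \<bullet> a $ i) \<le> (\<Sum>i\<in>UNIV. \<alpha> i * norm (fst p $ i))"
  proof (rule sum_mono)
    fix i
    have "fst p $ i \<bullet> a $ i \<le> norm (fst p $ i) * norm (a $ i)"
      by (rule norm_cauchy_schwarz)
    also have "\<dots> \<le> norm (fst p $ i) * \<alpha> i"
      using a by (intro mult_left_mono) auto
    finally show "fst p $ i \<bullet> a $ i \<le> \<alpha> i * norm (fst p $ i)"
      by (simp add: mult.commute)
  qed
  finally show ?thesis
    by (simp add: hamiltonian_def)
qed

lemma value_supersolution:
  assumes y: "y \<in> \<Omega>" and p: "p \<in> subdifferential \<Omega> V y"
  shows "hamiltonian \<alpha> y p \<ge> 0"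
proof -
  \<comment> \<open>Full speed along each pursuer block of \<open>p\<close> makes the pairing equal
    to \<open>\<alpha> i * norm (fst p $ i)\<close>; of the evader's reply \<open>e\<close> only
    \<open>norm e \<le> 1\<close> is used.\<close>
  define a where "a = (\<chi> i. \<alpha> i *\<^sub>R sgn (fst p $ i))"
  have "norm (a $ i) \<le> \<alpha> i" for i
    using \<alpha>[of i] by (simp add: a_def norm_sgn)
  then obtain e where e: "norm e \<le> 1" and ev: "\<forall>\<^sub>F h in at_right 0. V (y + h *\<^sub>R (a, e)) \<le> V y"
    using value_along_evader_motion[OF y] by metis
  have "0 \<le> (- p) \<bullet> (a, e)"
    by (rule superdifferential_nonneg_direction[OF open_game_domain y uminus_in_superdifferential[OF p],
          where C = 0]) (use ev in simp)
  then have "(\<Sum>i\<in>UNIV. fst p $ i \<bullet> a $ i) + snd p \<bullet> e \<le> 0"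
    unfolding inner_minus_left inner_state by (simp add: sum_negf)
  moreover have "fst p $ i \<bullet> a $ i = \<alpha> i * norm (fst p $ i)" for i
    by (simp add: a_def inner_sgn_self)
  moreover have "- (snd p \<bullet> e) \<le> norm (snd p)"
    using norm_cauchy_schwarz[of "snd p" "- e"] mult_left_mono[OF e, of "norm (snd p)"] by simp
  ultimately show ?thesis
    by (simp add: hamiltonian_def)
qed

end

text \<open>The first conjunct certifies that the minimum is attained, so that \<open>LEAST\<close>
  in \<open>value_fun\<close> denotes the true minimum on the closure of the domain.\<close>

theorem theorem4p1:
  fixes \<alpha> l :: "'m::finite \<Rightarrow> real"
    and g :: "real ^ 'n::finite \<Rightarrow> real"
  assumes "CARD('n) \<ge> 2"
    and "\<And>i. \<alpha> i > 1"
    and "\<And>i. l i > 0"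
    and "\<And>x. \<exists>u>0. \<exists>L. L-lipschitz_on (cball x u) g"
  shows "(\<forall>y \<in> game_domain l \<union> target_boundary l. \<exists>x \<in> joint_region \<alpha> l y.
            value_fun \<alpha> l g y = g x \<and> (\<forall>x' \<in> joint_region \<alpha> l y. g x \<le> g x'))
       \<and> continuous_on (game_domain l \<union> target_boundary l) (value_fun \<alpha> l g)
       \<and> viscosity_solution (game_domain l) (hamiltonian \<alpha>) (value_fun \<alpha> l g)
       \<and> (\<forall>y \<in> target_boundary l. value_fun \<alpha> l g y = g (snd y))"
proof -
  interpret pursuit_game \<alpha> l g
    using assms by unfold_locales auto
  have "viscosity_solution \<Omega> (hamiltonian \<alpha>) V"
    unfolding viscosity_solution_def
    using continuous_on_subset[OF continuous_on_value] value_subsolution value_supersolution by blast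
  moreover have "\<exists>x \<in> joint_region \<alpha> l y. V y = g x \<and> (\<forall>x' \<in> joint_region \<alpha> l y. g x \<le> g x')"
    if "y \<in> \<Omega>\<^sub>c" for y
    using value_attained[OF that] by metis
  ultimately show ?thesis
    using continuous_on_value value_boundary by blast
qed

end
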